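(* For $\mu\in\mathcal D$, let $(u(\mu),\lambda(\mu))\in V\times M$ be the solution of the parametrized primal problem, let $\lambda_n^{\rm pr}(\mu)\in M_n$ be the multiplier component of the primal reduced basis solution, let $s_n(\mu)\in M'$ be the dual (slack) reduced basis approximation, and let $u_n^{\rm du}(\mu)=B^{-1}(g(\mu)-s_n(\mu))$ (all as defined in the context). Let $\alpha_{\rm LB}(\mu)$ and $\gamma_{\rm UB}(\mu)$ satisfy $0<\alpha_{\rm LB}(\mu)\le\alpha(\mu)$ and $\gamma_{\rm UB}(\mu)\ge\gamma(\mu)$ for all $\mu\in\mathcal D$. Define $r(\mu)\in V'$ by $$r(v;\mu):=\langle f(\mu),v\rangle-\langle A(\mu)u_n^{\rm du}(\mu),v\rangle-\langle Bv,\lambda_n^{\rm pr}(\mu)\rangle,\qquad v\in V,$$ and let $$d_1(\mu):=\frac{\|r(\mu)\|_{V'}}{2\alpha_{\rm LB}(\mu)},\qquad d_2(\mu):=\frac{\langle s_n(\mu),\lambda_n^{\rm pr}(\mu)\rangle}{\alpha_{\rm LB}(\mu)}.$$ Then, for every $\mu\in\mathcal D$, $$\|u(\mu)-u_n^{\rm du}(\mu)\|_V\le\Delta_u^{\rm pr,du}(\mu):=d_1(\mu)+\sqrt{d_1(\mu)^2+d_2(\mu)},$$ $$\|\lambda(\mu)-\lambda_n^{\rm pr}(\mu)\|_Q\le\Delta_\lambda^{\rm pr,du}(\mu):=\frac1\beta\Big(\|r(\mu)\|_{V'}+\gamma_{\rm UB}(\mu)\,\Delta_u^{\rm pr,du}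(\mu)\Big).$$
   Context: Spaces. $\Omega\subset\mathbb R^d$, $d\in\{1,2,3\}$, is a bounded Lipschitz domain. $V,Q\subset L^2(\Omega)$ are real finite-dimensional Hilbert spaces (a "truth" discretization) with norms $\|\cdot\|_V,\|\cdot\|_Q$, duals $V',Q'$ (dual norm $\|\cdot\|_{V'}$), duality pairings $\langle\cdot,\cdot\rangle$, and bases $\{\Phi_i\}_{i=1}^{N_V}$, $\{\Psi_j\}_{j=1}^{N_Q}$. The $\Psi_j$ are nonnegative functions such that $M:=\{q\in Q:q\ge0\text{ a.e. in }\Omega\}=\{\sum_jc_j\Psi_j:c_j\ge0\}$. Put $M':=\{\zeta\in Q':\langle\zeta,q\rangle\ge0\ \forall q\in M\}$. Parametrized data. $\mathcal D\subset\mathbb R^p$ is compact. For $\mu\in\mathcal D$, $$A(\mu)=\sum_{k=1}^{Q_a}\Theta_a^k(\mu)A^k,\qquad f(\mu)=\sum_{k=1}^{Q_f}\Theta_f^k(\mu)f^k,\qquad g(\mu)=\sum_{k=1}^{Q_g}\Theta_g^k(\mu)g^k,$$ with continuous coefficient functions $\Theta^k_\bullet:\mathcal D\to\mathbb R$ and parameter-independent, linear, continuous $A^k:V\to V'$, $f^k\in V'$, $g^k\in Q'$. For every $\mu\in\mathcal D$, $$\gamma(\mu)=\sup_{w\in V}\sup_{v\in V}\frac{\langle A(\mu)w,v\rangle}{\|w\|_V\|v\|_V}<\infty,\qquad\alpha(\mu)=\inf_{v\in V}\frac{\langle A(\mu)v,v\rangle}{\|v\|_V^2}>0$$ (nonzero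 elements; $A(\mu)$ need not be symmetric). $B:V\to Q'$ is a parameter-independent, continuous, bijective linear map (so $N_V=N_Q$), with $\beta=\inf_{q\in Q}\sup_{v\in V}\frac{\langle Bv,q\rangle}{\|q\|_Q\|v\|_V}>0$ (nonzero elements). Primal problem. $(u(\mu),\lambda(\mu))\in V\times M$ is the unique pair with $\langle A(\mu)u(\mu),v\rangle+\langle Bv,\lambda(\mu)\rangle=\langle f(\mu),v\rangle$ for all $v\in V$ and $\langle Bu(\mu),q-\lambda(\mu)\rangle\le\langle g(\mu),q-\lambda(\mu)\rangle$ for all $q\in M$. Dual problem. Underlined letters denote coefficient vectors and matrices: $\underline A(\mu)_{ij}=\langle A(\mu)\Phi_j,\Phi_i\rangle$, $\underline B_{kj}=\langle B\Phi_j,\Psi_k\rangle$, $\underline f(\mu)_i=\langle f(\mu),\Phi_i\rangle$, $\underline g(\mu)_k=\langle g(\mu),\Psi_k\rangle$. Set $\underline{\tilde A}(\mu):=\underline B^{-T}\underline A(\mu)\underline B^{-1}$ and $\underline{\tilde f}(\mu):=\underline B^{-T}\underline A(\mu)\underline B^{-1}\underline g(\mu)-\underline B^{-T}\underline f(\mu)$. With $\mathbb R_+=[0,\infty)$, $\underline s(\mu)\in\mathbb R_+^{N_Q}$ is the unique vector with $(\underline\xi-\underline s(\mu))^T\underline{\tilde A}(\mu)\underline s(\mu)\ge(\underline\xi-\underline s(\mu))^T\underline{\tilde f}(\mu)$ for all $\underline\xi\in\mathbb R_+^{N_Q}$. Reduced basis spaces, for chosen snapshot parameters $\mu_i\in\mathcal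 D$. $Q_n=\mathrm{span}\{\psi_1,\dots,\psi_{n_Q}\}=\mathrm{span}\{\lambda(\mu_i):1\le i\le n\}$ with $\psi_i\in M$ linearly independent; $M_n=\{\sum_ic_i\psi_i:c_i\ge0\}$. $V_n=\mathrm{span}\{\varphi_1,\dots,\varphi_{n_V}\}=\mathrm{span}\{u(\mu_j),t_k:1\le j\le n,\,1\le k\le n_{\sup}\}$ with mutually orthogonal nonzero $\varphi_j\in V$, where $t_k\in V$ are additional ("supremizing") functions chosen so that $\inf_{q_n\in Q_n}\sup_{v_n\in V_n}\frac{\langle Bv_n,q_n\rangle}{\|q_n\|_Q\|v_n\|_V}>0$. $\underline S_n=\{\sum_ic_i\underline\zeta_i:c_i\ge0\}$ is the cone generated by linearly independent $\underline\zeta_1,\dots,\underline\zeta_{n_S}\in\mathbb R_+^{N_Q}$, and equals the set of nonnegative linear combinations of the snapshots $\underline s(\mu_i)$, $1\le i\le n_S'$. Reduced basis approximations. $(u_n^{\rm pr}(\mu),\lambda_n^{\rm pr}(\mu))\in V_n\times M_n$ is the unique pair with $\langle A(\mu)u_n^{\rm pr}(\mu),v_n\rangle+\langle Bv_n,\lambda_n^{\rm pr}(\mu)\rangle=\langle f(\mu),v_n\rangle$ for all $v_n\in V_n$ and $\langle Bu_n^{\rm pr}(\mu),q_n-\lambda_n^{\rm pr}(\mu)\rangle\le\langle g(\mu),q_n-\lambda_n^{\rm pr}(\mu)\rangle$ for all $q_n\in M_n$. $\underline s_n(\mu)\in\underline S_n$ is the unique vector with $(\underline\xi-\underline s_n(\mu))^T\underline{\tilde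 A}(\mu)\underline s_n(\mu)\ge(\underline\xi-\underline s_n(\mu))^T\underline{\tilde f}(\mu)$ for all $\underline\xi\in\underline S_n$. The functional $s_n(\mu)\in M'$ is determined by $\langle s_n(\mu),\Psi_j\rangle=\underline s_{n}(\mu)_j$, $1\le j\le N_Q$, and $u_n^{\rm du}(\mu):=B^{-1}(g(\mu)-s_n(\mu))\in V$. *)

theory Defs
  imports "HOL-Analysis.Analysis"
begin

(* Near each boundary point x, with respect to the direction e, the set is the strict epigraph
   of a Lipschitz function phi on the hyperplane orthogonal to e, inside a cylinder around x.
   In dimension one the hyperplane is {0}, and the condition says that the set lies
   on exactly one side of x. *)
definition lipschitz_domain :: "'a::euclidean_space set \<Rightarrow> bool" where
  "lipschitz_domain \<Omega> \<longleftrightarrow> \<Omega> \<noteq> {} \<and> open \<Omega> \<and> connected \<Omega> \<and>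
     (\<forall>x\<in>frontier \<Omega>. \<exists>e \<rho> h L (\<phi>::'a \<Rightarrow> real).
        norm e = 1 \<and> 0 < \<rho> \<and> 0 < h \<and>
        L-lipschitz_on {z. z \<bullet> e = 0} \<phi> \<and>
        (\<forall>z. z \<bullet> e = 0 \<and> norm z < \<rho> \<longrightarrow> \<bar>\<phi> z\<bar> < h) \<and>
        (\<forall>z t. z \<bullet> e = 0 \<and> norm z < \<rho> \<and> \<bar>t\<bar> < h \<longrightarrow>
           (x + z + t *\<^sub>R e \<in> \<Omega> \<longleftrightarrow> \<phi> z < t)))"

definition square_integrable_on :: "('a::euclidean_space \<Rightarrow> real) \<Rightarrow> 'a set \<Rightarrow> bool" where
  "square_integrable_on h \<Omega> \<longleftrightarrow>
     h \<in> borel_measurable (lebesgue_on \<Omega>) \<and> integrable (lebesgue_on \<Omega>) (\<lambda>x. (h x)\<^sup>2)"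

(* A finite-dimensional Hilbert space contained in L^2(Omega), with a norm of its own, is
   rendered as a Euclidean space 'v together with a linear injection of 'v into the square
   integrable functions modulo equality almost everywhere; E v is a representative of v. *)
definition L2_embedding :: "'a::euclidean_space set \<Rightarrow> ('v::euclidean_space \<Rightarrow> 'a \<Rightarrow> real) \<Rightarrow> bool" where
  "L2_embedding \<Omega> E \<longleftrightarrow>
     (\<forall>v. square_integrable_on (E v) \<Omega>) \<and>
     (\<forall>v w. AE x in lebesgue_on \<Omega>. E (v + w) x = E v x + E w x) \<and>
     (\<forall>c v. AE x in lebesgue_on \<Omega>. E (c *\<^sub>R v) x = c * E v x) \<and>
     (\<forall>v. (AE x in lebesgue_on \<Omega>. E v x = 0) \<longrightarrow> v = 0)"

definition ae_nonneg :: "'a::euclidean_space set \<Rightarrow> ('v \<Rightarrow> 'a \<Rightarrow> real) \<Rightarrow> 'v set" where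
  "ae_nonneg \<Omega> E = {q. AE x in lebesgue_on \<Omega>. 0 \<le> E q x}"

definition is_basis :: "('i \<Rightarrow> 'v::real_vector) \<Rightarrow> bool" where
  "is_basis \<Phi> \<longleftrightarrow> inj \<Phi> \<and> independent (range \<Phi>) \<and> span (range \<Phi>) = UNIV"

definition cone_generated :: "'i set \<Rightarrow> ('i \<Rightarrow> 'v::real_vector) \<Rightarrow> 'v set" where
  "cone_generated I p = {\<Sum>i\<in>I. c i *\<^sub>R p i | c. \<forall>i\<in>I. (0::real) \<le> c i}"

definition dual_cone :: "'v::real_normed_vector set \<Rightarrow> ('v \<Rightarrow>\<^sub>L real) set" where
  "dual_cone M = {\<zeta>. \<forall>q\<in>M. 0 \<le> blinfun_apply \<zeta> q}"

definition nonneg_orthant :: "(real^'n) set" where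
  "nonneg_orthant = {x. \<forall>i. 0 \<le> x $ i}"

definition affine_expansion :: "nat \<Rightarrow> (nat \<Rightarrow> 'p \<Rightarrow> real) \<Rightarrow> (nat \<Rightarrow> 'x::real_vector) \<Rightarrow> 'p \<Rightarrow> 'x" where
  "affine_expansion m \<Theta> X \<mu> = (\<Sum>k=1..m. \<Theta> k \<mu> *\<^sub>R X k)"

(* The topological dual of 'v is 'v =>_L real with the operator norm, and operators into it
   are of type 'v =>_L 'w =>_L real. The constants below are extended reals, so that finiteness
   is meaningful and suprema and infima over no elements are -\<infinity> and \<infinity>. *)
definition continuity_const :: "('v::real_normed_vector \<Rightarrow>\<^sub>L 'v \<Rightarrow>\<^sub>L real) \<Rightarrow> ereal" where
  "continuity_const a =
     (SUP w\<in>UNIV - {0}. SUP v\<in>UNIV - {0}. ereal (blinfun_apply (blinfun_apply a w) v / (norm w * norm v)))"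

definition coercivity_const :: "('v::real_normed_vector \<Rightarrow>\<^sub>L 'v \<Rightarrow>\<^sub>L real) \<Rightarrow> ereal" where
  "coercivity_const a =
     (INF v\<in>UNIV - {0}. ereal (blinfun_apply (blinfun_apply a v) v / (norm v)\<^sup>2))"

definition inf_sup_const ::
    "('v::real_normed_vector \<Rightarrow>\<^sub>L 'q::real_normed_vector \<Rightarrow>\<^sub>L real) \<Rightarrow> 'v set \<Rightarrow> 'q set \<Rightarrow> ereal" where
  "inf_sup_const b X Y =
     (INF q\<in>Y - {0}. SUP v\<in>X - {0}. ereal (blinfun_apply (blinfun_apply b v) q / (norm q * norm v)))"

definition saddle_solution ::
    "('v::real_normed_vector \<Rightarrow>\<^sub>L 'v \<Rightarrow>\<^sub>L real) \<Rightarrow> ('v \<Rightarrow>\<^sub>L 'q::real_normed_vector \<Rightarrow>\<^sub>L real) \<Rightarrow>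
     ('v \<Rightarrow>\<^sub>L real) \<Rightarrow> ('q \<Rightarrow>\<^sub>L real) \<Rightarrow> 'v set \<Rightarrow> 'q set \<Rightarrow> 'v \<Rightarrow> 'q \<Rightarrow> bool" where
  "saddle_solution a b f g X K u l \<longleftrightarrow> u \<in> X \<and> l \<in> K \<and>
     (\<forall>v\<in>X. blinfun_apply (blinfun_apply a u) v + blinfun_apply (blinfun_apply b v) l = blinfun_apply f v) \<and>
     (\<forall>q\<in>K. blinfun_apply (blinfun_apply b u) (q - l) \<le> blinfun_apply g (q - l))"

definition coeff_matrix ::
    "('v::real_normed_vector \<Rightarrow>\<^sub>L 'w::real_normed_vector \<Rightarrow>\<^sub>L real) \<Rightarrow> ('n \<Rightarrow> 'v) \<Rightarrow> ('m \<Rightarrow> 'w) \<Rightarrow> real^'n^'m" where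
  "coeff_matrix a \<Phi> \<Psi> = (\<chi> i j. blinfun_apply (blinfun_apply a (\<Phi> j)) (\<Psi> i))"

definition coeff_vector :: "('v::real_normed_vector \<Rightarrow>\<^sub>L real) \<Rightarrow> ('n \<Rightarrow> 'v) \<Rightarrow> real^'n" where
  "coeff_vector l \<Phi> = (\<chi> i. blinfun_apply l (\<Phi> i))"

definition dual_matrix :: "real^'n^'n \<Rightarrow> real^'n^'m \<Rightarrow> real^'m^'m" where
  "dual_matrix A B = transpose (matrix_inv B) ** A ** matrix_inv B"

definition dual_vector :: "real^'n^'n \<Rightarrow> real^'n^'m \<Rightarrow> real^'n \<Rightarrow> real^'m \<Rightarrow> real^'m" where
  "dual_vector A B f g =
     (transpose (matrix_inv B) ** A ** matrix_inv B) *v g - transpose (matrix_inv B) *v f"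

definition vi_solution :: "real^'m^'m \<Rightarrow> real^'m \<Rightarrow> (real^'m) set \<Rightarrow> real^'m \<Rightarrow> bool" where
  "vi_solution S F K s \<longleftrightarrow> s \<in> K \<and> (\<forall>\<xi>\<in>K. (\<xi> - s) \<bullet> (S *v s) \<ge> (\<xi> - s) \<bullet> F)"

definition functional_of :: "('m \<Rightarrow> 'q::real_normed_vector) \<Rightarrow> 'q set \<Rightarrow> real^'m \<Rightarrow> ('q \<Rightarrow>\<^sub>L real)" where
  "functional_of \<Psi> M s = (THE \<zeta>. \<zeta> \<in> dual_cone M \<and> (\<forall>j. blinfun_apply \<zeta> (\<Psi> j) = s $ j))"

definition residual ::
    "('v::real_normed_vector \<Rightarrow>\<^sub>L 'v \<Rightarrow>\<^sub>L real) \<Rightarrow> ('v \<Rightarrow>\<^sub>L 'q::real_normed_vector \<Rightarrow>\<^sub>L real) \<Rightarrow>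
     ('v \<Rightarrow>\<^sub>L real) \<Rightarrow> 'v \<Rightarrow> 'q \<Rightarrow> ('v \<Rightarrow>\<^sub>L real)" where
  "residual a b f w l =
     Blinfun (\<lambda>v. blinfun_apply f v - blinfun_apply (blinfun_apply a w) v - blinfun_apply (blinfun_apply b v) l)"

end

theory Submission
  imports Defs
begin

text \<open>
  Put \<open>e = u - u\<^sub>d\<^sub>u\<close> and \<open>\<eta> = \<lambda> - \<lambda>\<^sub>p\<^sub>r\<close>. The primal equation gives
  \<open>\<langle>A e, v\<rangle> + \<langle>B v, \<eta>\<rangle> = r(v)\<close>, and \<open>B e = (B u - g) + s\<^sub>n\<close>. Testing the primal variational
  inequality with \<open>\<lambda>\<^sub>p\<^sub>r \<in> M\<close> and using \<open>s\<^sub>n \<in> M'\<close> shows \<open>\<langle>B e, \<eta>\<rangle> \<ge> - \<langle>s\<^sub>n, \<lambda>\<^sub>p\<^sub>r\<rangle>\<close>, so \<open>v = e\<close>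
  yields a quadratic inequality for \<open>\<parallel>e\<parallel>\<close>. The bound on \<open>\<eta>\<close> is the inf-sup condition applied
  to \<open>\<langle>B v, \<eta>\<rangle> = r(v) - \<langle>A e, v\<rangle>\<close>.
\<close>

text \<open>Completing the square. The hypothesis itself forces the radicand to be nonnegative, so
  no sign condition on \<open>q\<close> has to be imposed.\<close>

lemma le_quadratic_root:
  fixes x :: real
  assumes "x\<^sup>2 \<le> 2 * p * x + q"
  shows "x \<le> p + sqrt (p\<^sup>2 + q)"
proof -
  have "(x - p)\<^sup>2 \<le> p\<^sup>2 + q"
    using assms by (simp add: power2_diff algebra_simps)
  then have "x - p \<le> sqrt (p\<^sup>2 + q)"
    by (rule real_le_rsqrt)
  then show ?thesis by simp
qed

section \<open>Generated cones and the functional with prescribed values on a basis\<close>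

text \<open>Substituting the expansions of the \<open>p i\<close> yields coefficients that are sums
  of products of nonnegative numbers. This will place the reduced cone \<open>Mn\<close> inside
  \<open>M\<close>.\<close>

lemma cone_generated_subset:
  assumes "\<And>i. i \<in> I \<Longrightarrow> p i \<in> cone_generated J q"
  shows "cone_generated I p \<subseteq> cone_generated J q"
proof
  fix x assume "x \<in> cone_generated I p"
  then obtain c where x: "x = (\<Sum>i\<in>I. c i *\<^sub>R p i)" and c: "\<forall>i\<in>I. 0 \<le> c i"
    unfolding cone_generated_def by auto
  have "\<forall>i\<in>I. \<exists>d. p i = (\<Sum>j\<in>J. d j *\<^sub>R q j) \<and> (\<forall>j\<in>J. 0 \<le> d j)"
    using assms unfolding cone_generated_def by auto
  then obtain d where d: "\<forall>i\<in>I. p i = (\<Sum>j\<in>J. d i j *\<^sub>R q j) \<and> (\<forall>j\<in>J. 0 \<le> d i j)"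
    by metis
  have "x = (\<Sum>i\<in>I. \<Sum>j\<in>J. (c i * d i j) *\<^sub>R q j)"
    unfolding x by (rule sum.cong) (simp_all add: d scaleR_sum_right)
  also have "\<dots> = (\<Sum>j\<in>J. (\<Sum>i\<in>I. c i * d i j) *\<^sub>R q j)"
    by (subst sum.swap) (simp add: scaleR_sum_left)
  finally have "x = (\<Sum>j\<in>J. (\<Sum>i\<in>I. c i * d i j) *\<^sub>R q j)" .
  moreover have "\<forall>j\<in>J. 0 \<le> (\<Sum>i\<in>I. c i * d i j)"
    using c d by (simp add: sum_nonneg)
  ultimately show "x \<in> cone_generated J q"
    unfolding cone_generated_def
    by (intro CollectI exI[where x = "\<lambda>j. \<Sum>i\<in>I. c i * d i j"] conjI)
qed

lemma cone_generated_subset_nonneg_orthant: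
  assumes "p ` I \<subseteq> nonneg_orthant"
  shows "cone_generated I p \<subseteq> nonneg_orthant"
  using assms unfolding cone_generated_def nonneg_orthant_def
  by (auto simp: image_subset_iff intro!: sum_nonneg mult_nonneg_nonneg)

text \<open>\<open>functional_of\<close> is a definite description, so existence and uniqueness must
  come first. Existence is linear extension from the basis, with nonnegativity on the cone inherited
  from the generators; uniqueness holds because the basis spans.\<close>

lemma functional_of_in_dual_cone:
  fixes \<Psi> :: "'m::finite \<Rightarrow> 'q::euclidean_space"
  assumes basis: "is_basis \<Psi>" and s: "s \<in> nonneg_orthant"
  shows "functional_of \<Psi> (cone_generated UNIV \<Psi>) s \<in> dual_cone (cone_generated UNIV \<Psi>)"
proof -
  let ?M = "cone_generated UNIV \<Psi>"
  have inj: "inj \<Psi>" and ind: "independent (range \<Psi>)" and span: "span (range \<Psi>) = UNIV"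
    using basis unfolding is_basis_def by auto
  \<comment> \<open>\<open>inv \<Psi>\<close> recovers the index of a basis vector, which is
    legitimate since \<open>\<Psi>\<close> is injective.\<close>
  obtain h :: "'q \<Rightarrow> real" where h: "linear h" "\<forall>x\<in>range \<Psi>. h x = s $ inv \<Psi> x"
    using linear_independent_extend[OF ind, of "\<lambda>x. s $ inv \<Psi> x"] by auto
  define \<zeta> where "\<zeta> = Blinfun h"
  have \<zeta>_apply: "blinfun_apply \<zeta> = h"
    unfolding \<zeta>_def using h(1) by (simp add: bounded_linear_Blinfun_apply linear_conv_bounded_linear)
  have \<zeta>_basis: "blinfun_apply \<zeta> (\<Psi> j) = s $ j" for j
    using h(2) inj by (simp add: \<zeta>_apply)
  have "\<zeta> \<in> dual_cone ?M"
    using s unfolding dual_cone_def cone_generated_def nonneg_orthant_def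
    by (auto simp: blinfun.sum_right blinfun.scaleR_right \<zeta>_basis intro!: sum_nonneg)
  moreover have "\<zeta>' = \<zeta>" if "\<forall>j. blinfun_apply \<zeta>' (\<Psi> j) = s $ j" for \<zeta>'
  proof (rule blinfun_eqI)
    fix x
    show "blinfun_apply \<zeta>' x = blinfun_apply \<zeta> x"
      by (rule linear_eq_on_span[where B = "range \<Psi>"])
        (auto simp: span that \<zeta>_basis blinfun.bounded_linear_right bounded_linear.linear)
  qed
  ultimately have "functional_of \<Psi> ?M s = \<zeta>"
    unfolding functional_of_def using \<zeta>_basis by (intro the_equality) blast+
  then show ?thesis
    using \<open>\<zeta> \<in> dual_cone ?M\<close> by simp
qed

section \<open>The residual and the continuity, coercivity and inf-sup constants\<close>

text \<open>\<open>Blinfun\<close> has the intended values only on bounded linear maps, so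
  boundedness has to be checked before the formula can be used.\<close>

lemma residual_apply:
  "blinfun_apply (residual a b f w l) v =
     blinfun_apply f v - blinfun_apply (blinfun_apply a w) v - blinfun_apply (blinfun_apply b v) l"
  unfolding residual_def
  by (subst bounded_linear_Blinfun_apply) (auto intro!: bounded_linear_intros)

lemma coercivity_const_le:
  assumes "ereal \<alpha> \<le> coercivity_const a"
  shows "\<alpha> * (norm v)\<^sup>2 \<le> blinfun_apply (blinfun_apply a v) v"
proof (cases "v = 0")
  case False
  then have "coercivity_const a \<le> ereal (blinfun_apply (blinfun_apply a v) v / (norm v)\<^sup>2)"
    unfolding coercivity_const_def by (intro INF_lower) auto
  with assms have "\<alpha> \<le> blinfun_apply (blinfun_apply a v) v / (norm v)\<^sup>2"
    using order_trans by fastforce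
  with False show ?thesis
    by (simp add: pos_le_divide_eq)
qed simp

lemma continuity_const_ge:
  assumes "continuity_const a \<le> ereal \<gamma>"
  shows "blinfun_apply (blinfun_apply a w) v \<le> \<gamma> * norm w * norm v"
proof (cases "w = 0 \<or> v = 0")
  case False
  then have "ereal (blinfun_apply (blinfun_apply a w) v / (norm w * norm v)) \<le> continuity_const a"
    unfolding continuity_const_def by (intro SUP_upper2[where i = w] SUP_upper) auto
  with assms have "blinfun_apply (blinfun_apply a w) v / (norm w * norm v) \<le> \<gamma>"
    using order_trans by fastforce
  with False show ?thesis
    by (simp add: pos_divide_le_eq mult.assoc)
qed (auto simp: blinfun.zero_left)

text \<open>The infimum is tested at the single element \<open>y\<close>. It serves twice: to show
  that the constant is finite and to bound the multiplier error.\<close>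

lemma inf_sup_const_le:
  assumes "y \<in> Y - {0}"
    and "\<And>v. v \<in> X \<Longrightarrow> blinfun_apply (blinfun_apply b v) y \<le> C * norm v"
  shows "inf_sup_const b X Y \<le> ereal (C / norm y)"
proof -
  have "inf_sup_const b X Y
      \<le> (SUP v\<in>X - {0}. ereal (blinfun_apply (blinfun_apply b v) y / (norm y * norm v)))"
    unfolding inf_sup_const_def using assms(1) by (rule INF_lower)
  also have "\<dots> \<le> ereal (C / norm y)"
  proof (rule SUP_least)
    fix v assume "v \<in> X - {0}"
    then show "ereal (blinfun_apply (blinfun_apply b v) y / (norm y * norm v)) \<le> ereal (C / norm y)"
      using assms by (simp add: field_simps)
  qed
  finally show ?thesis .
qed

text \<open>\<open>real_of_ereal\<close> sends infinite values to 0, so finiteness is needed before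
  \<open>\<beta>\<close> can stand for the constant. Positivity excludes minus infinity; a nonzero
  test vector, which every Euclidean space has, excludes plus infinity.\<close>

lemma inf_sup_const_finite:
  fixes b :: "'v::real_normed_vector \<Rightarrow>\<^sub>L 'q::euclidean_space \<Rightarrow>\<^sub>L real"
  assumes "inf_sup_const b X UNIV > 0"
  shows "ereal (real_of_ereal (inf_sup_const b X UNIV)) = inf_sup_const b X UNIV"
proof -
  obtain y :: 'q where y: "y \<in> Basis"
    using nonempty_Basis by blast
  have "blinfun_apply (blinfun_apply b v) y \<le> norm b * norm v" for v
  proof -
    have "blinfun_apply (blinfun_apply b v) y \<le> norm (blinfun_apply b v) * norm y"
      using norm_blinfun[of "blinfun_apply b v" y] by simp
    also have "\<dots> \<le> norm b * norm v"
      using norm_blinfun[of b v] y by simp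
    finally show ?thesis .
  qed
  then have "inf_sup_const b X UNIV \<le> ereal (norm b / norm y)"
    using y nonzero_Basis by (intro inf_sup_const_le) auto
  then show ?thesis
    using assms by (intro ereal_real') auto
qed

section \<open>Error bounds for the saddle point problem\<close>

lemma saddle_error_u:
  assumes sol: "saddle_solution a b f g UNIV M u l"
    and s: "s \<in> dual_cone M" and m: "m \<in> M"
    and w: "blinfun_apply b w = g - s"
    and coercive: "0 < \<alpha>" "ereal \<alpha> \<le> coercivity_const a"
  defines "\<rho> \<equiv> norm (residual a b f w m)"
  shows "norm (u - w) \<le>
    \<rho> / (2 * \<alpha>) + sqrt ((\<rho> / (2 * \<alpha>))\<^sup>2 + blinfun_apply s m / \<alpha>)"
proof (rule le_quadratic_root)
  let ?e = "u - w" and ?r = "residual a b f w m"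
  have eq: "blinfun_apply (blinfun_apply a u) ?e + blinfun_apply (blinfun_apply b ?e) l
      = blinfun_apply f ?e"
    and vi: "blinfun_apply (blinfun_apply b u) (m - l) \<le> blinfun_apply g (m - l)"
    and l: "l \<in> M"
    using sol m unfolding saddle_solution_def by auto
  have sl: "0 \<le> blinfun_apply s l"
    using s l unfolding dual_cone_def by auto
  \<comment> \<open>By \<open>w\<close>, the right-hand side is
    \<open>(b u - g) (l - m) + s l - s m\<close>. The first summand is nonnegative by
    \<open>vi\<close>, the second by \<open>sl\<close>.\<close>
  have "- blinfun_apply s m \<le> blinfun_apply (blinfun_apply b ?e) (l - m)"
    using vi sl by (simp add: w blinfun.diff_left blinfun.diff_right)
  moreover have "blinfun_apply (blinfun_apply a ?e) ?e
      = blinfun_apply ?r ?e - blinfun_apply (blinfun_apply b ?e) (l - m)"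
    using eq by (simp add: residual_apply blinfun.diff_left blinfun.diff_right)
  moreover have "blinfun_apply ?r ?e \<le> \<rho> * norm ?e"
    using norm_blinfun[of ?r ?e] unfolding \<rho>_def by simp
  ultimately have "\<alpha> * (norm ?e)\<^sup>2 \<le> \<rho> * norm ?e + blinfun_apply s m"
    using coercivity_const_le[OF coercive(2), of ?e] by linarith
  \<comment> \<open>Division by \<alpha> brings the estimate to the normal form of
    \<open>le_quadratic_root\<close>, which explains the factor 2 in the denominator of
    \<open>\<rho> / (2 * \<alpha>)\<close>.\<close>
  then show "(norm ?e)\<^sup>2 \<le> 2 * (\<rho> / (2 * \<alpha>)) * norm ?e + blinfun_apply s m / \<alpha>"
    using coercive(1) by (simp add: field_simps)
qed

text \<open>Here \<open>w\<close> and \<open>m\<close> are arbitrary. The bound keeps the true error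
  \<open>norm (u - w)\<close>, so any estimate of it can be inserted afterwards.\<close>

lemma saddle_error_multiplier:
  fixes b :: "'v::real_normed_vector \<Rightarrow>\<^sub>L 'q::euclidean_space \<Rightarrow>\<^sub>L real"
  assumes sol: "saddle_solution a b f g UNIV M u l"
    and cont: "continuity_const a \<le> ereal \<gamma>"
    and inf_sup: "inf_sup_const b UNIV UNIV > 0"
  defines "\<beta> \<equiv> real_of_ereal (inf_sup_const b UNIV UNIV)"
  shows "norm (l - m) \<le> 1 / \<beta> * (norm (residual a b f w m) + \<gamma> * norm (u - w))"
proof -
  let ?r = "residual a b f w m"
  let ?C = "norm ?r + \<gamma> * norm (u - w)"
  have \<beta>: "ereal \<beta> = inf_sup_const b UNIV UNIV"
    unfolding \<beta>_def using inf_sup by (rule inf_sup_const_finite)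
  have "0 < \<beta>"
    using inf_sup unfolding \<beta>[symmetric] by simp
  have bound: "blinfun_apply (blinfun_apply b v) (l - m) \<le> ?C * norm v" for v
  proof -
    have "blinfun_apply (blinfun_apply a u) v + blinfun_apply (blinfun_apply b v) l
        = blinfun_apply f v"
      using sol unfolding saddle_solution_def by auto
    \<comment> \<open>The minus sign is moved onto \<open>v\<close> because
      \<open>continuity_const_ge\<close> bounds the form from above only, without absolute
      values.\<close>
    then have "blinfun_apply (blinfun_apply b v) (l - m)
        = blinfun_apply ?r v + blinfun_apply (blinfun_apply a (u - w)) (- v)"
      by (simp add: residual_apply blinfun.diff_left blinfun.diff_right blinfun.minus_right)
    also have "\<dots> \<le> norm ?r * norm v + \<gamma> * norm (u - w) * norm (- v)"
      using norm_blinfun[of ?r v] continuity_const_ge[OF cont, of "u - w" "- v"]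
      by (intro add_mono) auto
    finally show ?thesis by (simp add: algebra_simps)
  qed
  have "\<beta> * norm (l - m) \<le> ?C"
  proof (cases "l = m")
    \<comment> \<open>The inf-sup quotient excludes 0, so \<open>0 \<le> ?C\<close> must be shown
      directly, with no sign of \<gamma> at hand: \<open>bound\<close> at \<open>u - w\<close> gives
      it if \<open>u \<noteq> w\<close>, and otherwise \<open>?C\<close> is just the residual
      norm.\<close>
    case True
    show ?thesis
      using bound[of "u - w"] by (cases "u = w") (simp_all add: True zero_le_mult_iff)
  next
    case False
    then have "ereal \<beta> \<le> ereal (?C / norm (l - m))"
      unfolding \<beta> using bound by (intro inf_sup_const_le) auto
    with False show ?thesis by (simp add: pos_le_divide_eq)
  qed
  with \<open>0 < \<beta>\<close> show ?thesis by (simp add: field_simps)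
qed

theorem corollary5p2:
  fixes \<Omega> :: "(real^'d) set"
    and EV :: "'v::euclidean_space \<Rightarrow> real^'d \<Rightarrow> real"
    and EQ :: "'q::euclidean_space \<Rightarrow> real^'d \<Rightarrow> real"
    and \<Phi> :: "'nv::finite \<Rightarrow> 'v" and \<Psi> :: "'nq::finite \<Rightarrow> 'q"
    and D :: "(real^'p) set"
    and Qa Qf Qg :: nat
    and \<Theta>a \<Theta>f \<Theta>g :: "nat \<Rightarrow> real^'p \<Rightarrow> real"
    and Ak :: "nat \<Rightarrow> 'v \<Rightarrow>\<^sub>L 'v \<Rightarrow>\<^sub>L real"
    and fk :: "nat \<Rightarrow> 'v \<Rightarrow>\<^sub>L real"
    and gk :: "nat \<Rightarrow> 'q \<Rightarrow>\<^sub>L real"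
    and B :: "'v \<Rightarrow>\<^sub>L 'q \<Rightarrow>\<^sub>L real"
    and u :: "real^'p \<Rightarrow> 'v" and lam :: "real^'p \<Rightarrow> 'q" and s :: "real^'p \<Rightarrow> real^'nq"
    and \<mu>s :: "nat \<Rightarrow> real^'p" and n nQ nV nsup nS nS' :: nat
    and \<psi> :: "nat \<Rightarrow> 'q" and \<phi> t :: "nat \<Rightarrow> 'v" and \<zeta> :: "nat \<Rightarrow> real^'nq"
    and upr :: "real^'p \<Rightarrow> 'v" and lampr :: "real^'p \<Rightarrow> 'q" and svec :: "real^'p \<Rightarrow> real^'nq"
    and \<alpha>LB \<gamma>UB :: "real^'p \<Rightarrow> real"
    and M :: "'q set"
    and A :: "real^'p \<Rightarrow> 'v \<Rightarrow>\<^sub>L 'v \<Rightarrow>\<^sub>L real"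
    and f :: "real^'p \<Rightarrow> 'v \<Rightarrow>\<^sub>L real" and g :: "real^'p \<Rightarrow> 'q \<Rightarrow>\<^sub>L real"
    and \<beta> :: real
    and Amat :: "real^'p \<Rightarrow> real^'nv^'nv" and Bmat :: "real^'nv^'nq"
    and fvec :: "real^'p \<Rightarrow> real^'nv" and gvec :: "real^'p \<Rightarrow> real^'nq"
    and Qn Mn :: "'q set" and Vn :: "'v set" and Sn :: "(real^'nq) set"
    and sn :: "real^'p \<Rightarrow> 'q \<Rightarrow>\<^sub>L real" and udu :: "real^'p \<Rightarrow> 'v"
    and r :: "real^'p \<Rightarrow> 'v \<Rightarrow>\<^sub>L real"
    and d1 d2 \<Delta>u \<Delta>lam :: "real^'p \<Rightarrow> real"
  defines "M \<equiv> ae_nonneg \<Omega> EQ"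
    and "A \<equiv> affine_expansion Qa \<Theta>a Ak"
    and "f \<equiv> affine_expansion Qf \<Theta>f fk"
    and "g \<equiv> affine_expansion Qg \<Theta>g gk"
    and "\<beta> \<equiv> real_of_ereal (inf_sup_const B UNIV UNIV)"
    and "Amat \<equiv> \<lambda>\<mu>. coeff_matrix (A \<mu>) \<Phi> \<Phi>"
    and "Bmat \<equiv> coeff_matrix B \<Phi> \<Psi>"
    and "fvec \<equiv> \<lambda>\<mu>. coeff_vector (f \<mu>) \<Phi>"
    and "gvec \<equiv> \<lambda>\<mu>. coeff_vector (g \<mu>) \<Psi>"
    and "Qn \<equiv> span (\<psi> ` {1..nQ})"
    and "Mn \<equiv> cone_generated {1..nQ} \<psi>"
    and "Vn \<equiv> span (\<phi> ` {1..nV})"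
    and "Sn \<equiv> cone_generated {1..nS} \<zeta>"
    and "sn \<equiv> \<lambda>\<mu>. functional_of \<Psi> M (svec \<mu>)"
    and "udu \<equiv> \<lambda>\<mu>. inv (blinfun_apply B) (g \<mu> - sn \<mu>)"
    and "r \<equiv> \<lambda>\<mu>. residual (A \<mu>) B (f \<mu>) (udu \<mu>) (lampr \<mu>)"
    and "d1 \<equiv> \<lambda>\<mu>. norm (r \<mu>) / (2 * \<alpha>LB \<mu>)"
    and "d2 \<equiv> \<lambda>\<mu>. blinfun_apply (sn \<mu>) (lampr \<mu>) / \<alpha>LB \<mu>"
    and "\<Delta>u \<equiv> \<lambda>\<mu>. d1 \<mu> + sqrt ((d1 \<mu>)\<^sup>2 + d2 \<mu>)"
    and "\<Delta>lam \<equiv> \<lambda>\<mu>. 1 / \<beta> * (norm (r \<mu>) + \<gamma>UB \<mu> * \<Delta>u \<mu>)"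
  assumes dim: "CARD('d) \<in> {1, 2, 3}"
    and domain: "bounded \<Omega>" "lipschitz_domain \<Omega>"
    and spaces: "L2_embedding \<Omega> EV" "L2_embedding \<Omega> EQ"
    and bases: "is_basis \<Phi>" "is_basis \<Psi>"
    and Psi_nonneg: "\<And>j. AE x in lebesgue_on \<Omega>. 0 \<le> EQ (\<Psi> j) x"
    and M_cone: "M = cone_generated UNIV \<Psi>"
    and D: "compact D"
    and Theta_a: "\<And>k. k \<in> {1..Qa} \<Longrightarrow> continuous_on D (\<Theta>a k)"
    and Theta_f: "\<And>k. k \<in> {1..Qf} \<Longrightarrow> continuous_on D (\<Theta>f k)"
    and Theta_g: "\<And>k. k \<in> {1..Qg} \<Longrightarrow> continuous_on D (\<Theta>g k)"
    and bounded_A: "\<And>\<mu>. \<mu> \<in> D \<Longrightarrow> continuity_const (A \<mu>) < \<infinity>"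
    and coercive_A: "\<And>\<mu>. \<mu> \<in> D \<Longrightarrow> coercivity_const (A \<mu>) > 0"
    and bij_B: "bij (blinfun_apply B)"
    and inf_sup_B: "inf_sup_const B UNIV UNIV > 0"
    and primal: "\<And>\<mu>. \<mu> \<in> D \<Longrightarrow> saddle_solution (A \<mu>) B (f \<mu>) (g \<mu>) UNIV M (u \<mu>) (lam \<mu>)"
    and dual: "\<And>\<mu>. \<mu> \<in> D \<Longrightarrow>
          vi_solution (dual_matrix (Amat \<mu>) Bmat) (dual_vector (Amat \<mu>) Bmat (fvec \<mu>) (gvec \<mu>))
            nonneg_orthant (s \<mu>)"
    and snapshots: "\<And>i. i \<in> {1..max n nS'} \<Longrightarrow> \<mu>s i \<in> D"
    and psi: "\<psi> ` {1..nQ} \<subseteq> M" "inj_on \<psi> {1..nQ}" "independent (\<psi> ` {1..nQ})"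
    and Qn: "Qn = span ((\<lambda>i. lam (\<mu>s i)) ` {1..n})"
    and phi: "\<And>i. i \<in> {1..nV} \<Longrightarrow> \<phi> i \<noteq> 0"
          "\<And>i j. i \<in> {1..nV} \<Longrightarrow> j \<in> {1..nV} \<Longrightarrow> i \<noteq> j \<Longrightarrow> \<phi> i \<bullet> \<phi> j = 0"
    and Vn: "Vn = span ((\<lambda>j. u (\<mu>s j)) ` {1..n} \<union> t ` {1..nsup})"
    and inf_sup_Vn_Qn: "inf_sup_const B Vn Qn > 0"
    and zeta: "\<zeta> ` {1..nS} \<subseteq> nonneg_orthant" "inj_on \<zeta> {1..nS}" "independent (\<zeta> ` {1..nS})"
    and Sn: "Sn = cone_generated {1..nS'} (\<lambda>i. s (\<mu>s i))"
    and rb_primal: "\<And>\<mu>. \<mu> \<in> D \<Longrightarrow> saddle_solution (A \<mu>) B (f \<mu>) (g \<mu>) Vn Mn (upr \<mu>) (lampr \<mu>)"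
    and rb_dual: "\<And>\<mu>. \<mu> \<in> D \<Longrightarrow>
          vi_solution (dual_matrix (Amat \<mu>) Bmat) (dual_vector (Amat \<mu>) Bmat (fvec \<mu>) (gvec \<mu>))
            Sn (svec \<mu>)"
    and alpha_LB: "\<And>\<mu>. \<mu> \<in> D \<Longrightarrow> 0 < \<alpha>LB \<mu> \<and> ereal (\<alpha>LB \<mu>) \<le> coercivity_const (A \<mu>)"
    and gamma_UB: "\<And>\<mu>. \<mu> \<in> D \<Longrightarrow> continuity_const (A \<mu>) \<le> ereal (\<gamma>UB \<mu>)"
  shows "\<forall>\<mu>\<in>D. norm (u \<mu> - udu \<mu>) \<le> \<Delta>u \<mu> \<and> norm (lam \<mu> - lampr \<mu>) \<le> \<Delta>lam \<mu>"
proof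
  fix \<mu> assume \<mu>: "\<mu> \<in> D"
  \<comment> \<open>Nonnegative generators keep the whole reduced cone in the orthant; this is what
    makes the reduced slack an element of the dual cone.\<close>
  have "svec \<mu> \<in> nonneg_orthant"
    using rb_dual[OF \<mu>] cone_generated_subset_nonneg_orthant[OF zeta(1)]
    unfolding vi_solution_def Sn_def by auto
  then have s: "sn \<mu> \<in> dual_cone M"
    unfolding sn_def M_cone by (rule functional_of_in_dual_cone[OF bases(2)])
  have "Mn \<subseteq> M"
    unfolding Mn_def M_cone using psi(1) M_cone by (intro cone_generated_subset) auto
  then have m: "lampr \<mu> \<in> M"
    using rb_primal[OF \<mu>] unfolding saddle_solution_def by auto
  have w: "blinfun_apply B (udu \<mu>) = g \<mu> - sn \<mu>"
    unfolding udu_def using bij_B by (simp add: bij_is_surj surj_f_inv_f)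
  have \<alpha>: "0 < \<alpha>LB \<mu>" "ereal (\<alpha>LB \<mu>) \<le> coercivity_const (A \<mu>)"
    using alpha_LB[OF \<mu>] by auto
  have err_u: "norm (u \<mu> - udu \<mu>) \<le> \<Delta>u \<mu>"
    using saddle_error_u[OF primal[OF \<mu>] s m w \<alpha>]
    unfolding \<Delta>u_def d1_def d2_def r_def by simp
  \<comment> \<open>On a unit vector, \<open>\<alpha>LB\<close> bounds the form from below and
    \<open>\<gamma>UB\<close> bounds it from above. The sign is what allows the true error to be
    replaced by \<open>\<Delta>u\<close> in the multiplier bound.\<close>
  have "0 \<le> \<gamma>UB \<mu>"
  proof -
    obtain v :: 'v where v: "norm v = 1"
      using vector_choose_size[of 1] by auto
    show ?thesis
      using coercivity_const_le[OF \<alpha>(2), of v] continuity_const_ge[OF gamma_UB[OF \<mu>], of v v]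
        \<alpha>(1) v by simp
  qed
  have \<beta>: "0 \<le> \<beta>"
    unfolding \<beta>_def using inf_sup_B by (simp add: real_of_ereal_pos)
  have "norm (lam \<mu> - lampr \<mu>) \<le> 1 / \<beta> * (norm (r \<mu>) + \<gamma>UB \<mu> * norm (u \<mu> - udu \<mu>))"
    unfolding \<beta>_def r_def
    by (rule saddle_error_multiplier[OF primal[OF \<mu>] gamma_UB[OF \<mu>] inf_sup_B])
  also have "\<dots> \<le> \<Delta>lam \<mu>"
    unfolding \<Delta>lam_def using err_u \<open>0 \<le> \<gamma>UB \<mu>\<close> \<beta> by (intro mult_left_mono add_left_mono) auto
  finally show "norm (u \<mu> - udu \<mu>) \<le> \<Delta>u \<mu> \<and> norm (lam \<mu> - lampr \<mu>) \<le> \<Delta>lam \<mu>"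
    using err_u by simp
qed

end
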